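(* Let $\alpha\in(1,2]$, $\sigma>0$, $u>0$, $S>0$, $0<K_-<K_+$, $r\in\mathbb{R}$, $\tau>0$, let $X_t\sim L(0,\sigma^\alpha,-1)$, and put $\mu=\sigma^\alpha/\cos\frac{\pi\alpha}{2}$ and $k_u^{\pm}:=\log\frac{S}{K_\pm^{1/u}}+r\tau$. The value of the capped European power call option, i.e. the option with payoff $(S_T^u-K_-)\mathbf{1}_{\{K_-<S_T^u<K_+\}}$, is $$C_\alpha^{(E,cap)}=C_\alpha^{(A/N,cap)}-K_-\,C_\alpha^{(C/N,cap)},$$ where $$C_\alpha^{(A/N,cap)}=\frac{e^{-r\tau}}{\alpha}S^u e^{u(r+\mu)\tau}\sum_{n=0}^\infty\sum_{m=0}^\infty\frac{(-u)^m\left((k_u^-+\mu\tau)^{1+n+m}-(k_u^++\mu\tau)^{1+n+m}\right)}{(1+n+m)\,n!\,m!\,\Gamma\left(1-\frac{1+n}{\alpha}\right)}\,(-\mu\tau)^{-\frac{1+n}{\alpha}},$$ $$C_\alpha^{(C/N,cap)}=\frac{e^{-r\tau}}{\alpha}\sum_{n=0}^\infty\frac{1}{n!\,\Gamma\left(1-\frac{n}{\alpha}\right)}\left((k_u^-+\mu\tau)^n-(k_u^++\mu\tau)^n\right)(-\mu\tau)^{-\frac{n}{\alpha}}.$$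
   Context: The process $X_t\sim L(0,\sigma^\alpha,-1)$ is the spectrally negative $\alpha$-stable Lévy process with characteristic function $\mathbb{E}[e^{ikX_t}]=\exp\left(-t\,\sigma^\alpha|k|^\alpha\left(1+i\tan\frac{\alpha\pi}{2}\,\mathrm{sgn}\,k\right)\right)$ for $k\in\mathbb{R}$; equivalently $\mathbb{E}[e^{pX_t}]=e^{-\mu t p^\alpha}$ for $p>0$, with $\mu=\sigma^\alpha/\cos\frac{\pi\alpha}{2}<0$. The asset price at maturity is $S_T=S\,e^{(r+\mu)\tau+X_\tau}$, where $\tau$ is the time-to-maturity, and the value of an option with payoff $\mathcal{P}(S_T,K_+,K_-)$ is $e^{-r\tau}\,\mathbb{E}\left[\mathcal{P}\left(Se^{(r+\mu)\tau+X_\tau},K_+,K_-\right)\right]$. Conventions: $1/\Gamma(z)=0$ when $z$ is a non-positive integer, and $0^0=1$. *)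

theory Defs
  imports "HOL-Probability.Probability"
begin

locale levy_process = prob_space M for M :: "'a measure" +
  fixes X :: "real \<Rightarrow> 'a \<Rightarrow> real"
  assumes random_variable_process: "\<And>t. 0 \<le> t \<Longrightarrow> random_variable borel (X t)"
    and starts_at_zero: "AE \<omega> in M. X 0 \<omega> = 0"
    and independent_increments:
      "\<And>(t :: nat \<Rightarrow> real) n. 0 \<le> t 0 \<Longrightarrow> strict_mono t \<Longrightarrow>
         indep_vars (\<lambda>_. borel) (\<lambda>i \<omega>. X (t (Suc i)) \<omega> - X (t i) \<omega>) {..<n}"
    and stationary_increments:
      "\<And>s h. 0 \<le> s \<Longrightarrow> 0 \<le> h \<Longrightarrow>
         distr M borel (\<lambda>\<omega>. X (s + h) \<omega> - X s \<omega>) = distr M borel (X h)"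
    and stochastically_continuous:
      "\<And>t \<epsilon>. 0 \<le> t \<Longrightarrow> 0 < \<epsilon> \<Longrightarrow>
         ((\<lambda>s. prob {\<omega> \<in> space M. \<epsilon> \<le> \<bar>X s \<omega> - X t \<omega>\<bar>}) \<longlongrightarrow> 0) (at t within {0..})"
    and cadlag:
      "AE \<omega> in M. (\<forall>t\<ge>0. ((\<lambda>s. X s \<omega>) \<longlongrightarrow> X t \<omega>) (at_right t)) \<and>
                  (\<forall>t>0. \<exists>l. ((\<lambda>s. X s \<omega>) \<longlongrightarrow> l) (at_left t))"

text \<open>
  The law $L(0, \sigma^\alpha, -1)$: zero location and skewness parameter $-1$, which is what
  makes the process spectrally negative.  In \<^term>\<open>\<bar>k\<bar> powr \<alpha>\<close> the value at
  \<^term>\<open>k = (0::real)\<close> is \<^term>\<open>0::real\<close>, as required.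
\<close>

locale spectrally_negative_stable_process = levy_process M X
  for M :: "'a measure" and X :: "real \<Rightarrow> 'a \<Rightarrow> real" +
  fixes \<alpha> \<sigma> :: real
  assumes characteristic_function:
    "\<And>t k. 0 \<le> t \<Longrightarrow>
       char (distr M borel (X t)) k =
         exp (- complex_of_real (t * \<sigma> powr \<alpha> * \<bar>k\<bar> powr \<alpha>) *
              (1 + \<i> * complex_of_real (tan (\<alpha> * pi / 2) * sgn k)))"

definition asset_price :: "(real \<Rightarrow> 'a \<Rightarrow> real) \<Rightarrow> real \<Rightarrow> real \<Rightarrow> real \<Rightarrow> real \<Rightarrow> 'a \<Rightarrow> real" where
  "asset_price X S r \<mu> \<tau> \<omega> = S * exp ((r + \<mu>) * \<tau> + X \<tau> \<omega>)"

definition option_value ::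
    "'a measure \<Rightarrow> (real \<Rightarrow> 'a \<Rightarrow> real) \<Rightarrow> real \<Rightarrow> real \<Rightarrow> real \<Rightarrow> real \<Rightarrow> (real \<Rightarrow> real) \<Rightarrow> real" where
  "option_value M X S r \<mu> \<tau> payoff =
     exp (- r * \<tau>) * (\<integral>\<omega>. payoff (asset_price X S r \<mu> \<tau> \<omega>) \<partial>M)"

definition capped_power_call_payoff :: "real \<Rightarrow> real \<Rightarrow> real \<Rightarrow> real \<Rightarrow> real" where
  "capped_power_call_payoff u K\<^sub>m K\<^sub>p s = (s powr u - K\<^sub>m) * indicator {K\<^sub>m<..<K\<^sub>p} (s powr u)"

end

theory Submission
  imports Defs
begin

text \<open>
  With \<open>c = - \<mu> \<tau> > 0\<close> the characteristic function of \<open>X \<tau>\<close> is \<open>exp (c (i t) powr \<alpha>)\<close>.  Since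
  \<open>\<alpha> > 1\<close>, it decays faster than any exponential, so Fourier inversion may be expanded in powers
  of the space variable: the law has an entire density, whose Taylor coefficients are the moments of the
  characteristic function.  These are Gamma integrals along a rotated ray, and the reflection
  formula turns them into
  \<open>(- x) ^ n / n! * rGamma (1 - (n + 1) / \<alpha>) / \<alpha> * c powr (- (n + 1) / \<alpha>)\<close>.
  The payoff is supported on a bounded interval of values of \<open>X \<tau>\<close>, on which this series, multiplied
  by the series of \<open>exp (u x)\<close>, is integrated term by term.
\<close>

subsection \<open>Gamma-type integrals with a complex rate\<close>

text \<open>The substitution \<open>t = c * k powr \<alpha>\<close> turns this into Euler's integral
  for \<open>Gamma (q / \<alpha>)\<close>.\<close>

lemma has_bochner_integral_powr_exp_neg_powr:
  fixes \<alpha> c q :: real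
  assumes "0 < \<alpha>" "0 < c" "0 < q"
  shows "has_bochner_integral lborel
    (\<lambda>k. indicator {0<..} k * (k powr (q - 1) * exp (- c * k powr \<alpha>)))
    (Gamma (q / \<alpha>) / \<alpha> * c powr (- (q / \<alpha>)))"
proof -
  define s where "s = q / \<alpha>"
  have s: "s > 0" using assms by (simp add: s_def)
  define f where "f = (\<lambda>t::real. t powr (s - 1) / exp t)"
  define g where "g = (\<lambda>k. c * k powr \<alpha>)"
  define g' where "g' = (\<lambda>k. c * \<alpha> * k powr (\<alpha> - 1))"
  have image: "g ` {0<..} = {0<..}"
  proof (intro equalityI subsetI)
    fix y :: real assume "y \<in> {0<..}"
    then have "g ((y / c) powr (1 / \<alpha>)) = y" "(y / c) powr (1 / \<alpha>) > 0"
      using assms by (auto simp: g_def powr_powr)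
    then show "y \<in> g ` {0<..}" by (metis greaterThan_iff imageI)
  qed (use assms in \<open>auto simp: g_def\<close>)
  have inj: "inj_on g {0<..}"
    using assms by (intro inj_on_inverseI[where g = "\<lambda>y. (y / c) powr (1 / \<alpha>)"]) (auto simp: g_def powr_powr)
  have deriv: "(g has_field_derivative g' x) (at x within {0<..})" if "x \<in> {0<..}" for x
    using that unfolding g_def g'_def by (auto intro!: derivative_eq_intros)
  have "(f has_integral Gamma s) {0<..}"
  proof -
    have "(\<lambda>t. if t \<in> {0..} then f t else 0) = (\<lambda>t. if t \<in> {0<..} then f t else 0)"
      by (auto simp: f_def)
    then show ?thesis
      using Gamma_integral_real[OF s, folded f_def] has_integral_restrict_UNIV by metis
  qed
  moreover have "f absolutely_integrable_on {0<..}"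
    using calculation by (subst absolutely_integrable_on_iff_nonneg) (auto simp: f_def)
  ultimately have "f absolutely_integrable_on g ` {0<..} \<and> integral (g ` {0<..}) f = Gamma s"
    unfolding image by (auto simp: integral_unique)
  then have abs: "(\<lambda>x. \<bar>g' x\<bar> * f (g x)) absolutely_integrable_on {0<..} \<and>
      integral {0<..} (\<lambda>x. \<bar>g' x\<bar> * f (g x)) = Gamma s"
    by (subst has_absolute_integral_change_of_variables_1'[OF _ deriv inj]) auto
  have eq: "\<bar>g' k\<bar> * f (g k) = \<alpha> * c powr s * (k powr (q - 1) * exp (- c * k powr \<alpha>))"
    if "k \<in> {0<..}" for k
  proof -
    have "\<alpha> * s = q" using assms by (simp add: s_def)
    then have "k powr (\<alpha> - 1) * (k powr \<alpha>) powr (s - 1) = k powr (q - 1)"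
      using that by (simp add: powr_powr algebra_simps flip: powr_add)
    moreover have "c * c powr (s - 1) = c powr s"
      using assms powr_add[of c 1 "s - 1"] by simp
    ultimately show ?thesis
      using assms that by (simp add: g'_def f_def g_def powr_mult exp_minus field_simps)
  qed
  have "set_integrable lebesgue {0<..} (\<lambda>x. \<bar>g' x\<bar> * f (g x)) \<longleftrightarrow> set_integrable lebesgue {0<..} (\<lambda>k. \<alpha> * c powr s * (k powr (q - 1) * exp (- c * k powr \<alpha>)))"
    using eq by (rule set_integrable_cong[OF refl refl])
  with abs have *: "set_integrable lebesgue {0<..} (\<lambda>k. \<alpha> * c powr s * (k powr (q - 1) * exp (- c * k powr \<alpha>)))" by simp
  have "integral {0<..} (\<lambda>x. \<bar>g' x\<bar> * f (g x)) = integral {0<..} (\<lambda>k. \<alpha> * c powr s * (k powr (q - 1) * exp (- c * k powr \<alpha>)))"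
    using eq by (rule Henstock_Kurzweil_Integration.integral_cong)
  with abs have **: "integral {0<..} (\<lambda>k. \<alpha> * c powr s * (k powr (q - 1) * exp (- c * k powr \<alpha>))) = Gamma s" by simp
  have int: "set_integrable lborel {0<..} (\<lambda>k. \<alpha> * c powr s * (k powr (q - 1) * exp (- c * k powr \<alpha>)))"
    using * unfolding set_integrable_def by (subst (asm) integrable_completion) simp_all
  have "has_bochner_integral lborel
      (\<lambda>k. indicator {0<..} k *\<^sub>R (\<alpha> * c powr s * (k powr (q - 1) * exp (- c * k powr \<alpha>)))) (Gamma s)"
    using int set_borel_integral_eq_integral(2)[OF int] **
    unfolding has_bochner_integral_iff set_integrable_def set_lebesgue_integral_def by simp
  then have "has_bochner_integral lborel
      (\<lambda>k. c powr (-s) / \<alpha> * (indicator {0<..} k *\<^sub>R (\<alpha> * c powr s * (k powr (q - 1) * exp (- c * k powr \<alpha>)))))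
      (c powr (-s) / \<alpha> * Gamma s)"
    by (rule has_bochner_integral_mult_right)
  then show ?thesis
    using assms by (simp add: s_def powr_minus_divide mult_ac)
qed

text \<open>Analytic continuation of the real-rate formula to \<open>Re z > 0\<close>, with the
  principal power of \<open>z\<close>. A single Taylor expansion in the rate achieves it, so the
  rotated ray never has to be handled as a contour.\<close>

lemma has_bochner_integral_powr_exp_neg_powr_complex:
  fixes \<alpha> q :: real and z :: complex
  assumes "0 < \<alpha>" "0 < Re z" "0 < q"
  shows "has_bochner_integral lborel
    (\<lambda>k. indicator {0<..} k *\<^sub>R (of_real (k powr (q - 1)) * exp (- z * of_real (k powr \<alpha>))))
    (of_real (Gamma (q / \<alpha>) / \<alpha>) * z powr (- of_real (q / \<alpha>)))"
proof -
  define s where "s = q / \<alpha>"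
  have s: "s > 0" using assms by (simp add: s_def)
  \<comment> \<open>Expand about a real point \<open>x\<close> so far to the right that its disc of convergence contains \<open>z\<close>;
    the integrated Taylor series is then a binomial series.\<close>
  define x where "x = (cmod z)\<^sup>2 / Re z"
  have "z \<noteq> 0" using assms by auto
  then have x: "x > 0" using assms by (simp add: x_def)
  \<comment> \<open>By the choice of \<open>x\<close>, \<open>x * Re z\<close> is the square of
    \<open>cmod z\<close>, so the squared distance from \<open>x\<close> to \<open>z\<close> is
    \<open>x\<^sup>2\<close> minus that square.\<close>
  have "(cmod (of_real x - z))\<^sup>2 = x\<^sup>2 - 2 * (x * Re z) + (cmod z)\<^sup>2"
    unfolding cmod_power2 by (simp add: power2_eq_square algebra_simps)
  also have "x * Re z = (cmod z)\<^sup>2" using assms by (simp add: x_def)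
  also have "x\<^sup>2 - 2 * (cmod z)\<^sup>2 + (cmod z)\<^sup>2 < x\<^sup>2" using assms by auto
  finally have close: "cmod (of_real x - z) < x" using x by (simp add: power2_less_imp_less)
  define w where "w = (of_real x - z) / of_real x"
  have w: "cmod w < 1" using close x by (simp add: w_def norm_divide)
  \<comment> \<open>Terms of the series of \<open>exp ((x - z) * k powr \<alpha>)\<close>, each
    times the integrand of real rate \<open>x\<close>; the factor
    \<open>(k powr \<alpha>) ^ j\<close> raises the exponent \<open>q\<close> to
    \<open>q + \<alpha> * real j\<close>.\<close>
  define f where "f = (\<lambda>j k. (of_real x - z) ^ j / fact j *
     complex_of_real (indicator {0<..} k * (k powr (q + \<alpha> * real j - 1) * exp (- x * k powr \<alpha>))))"
  define v where "v = (\<lambda>j. Gamma (s + real j) / \<alpha> * x powr (- (s + real j)))"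
  have v: "v j = Gamma s / \<alpha> * x powr (-s) * (pochhammer s j / x ^ j)" for j
  proof -
    have "s \<notin> \<int>\<^sub>\<le>\<^sub>0" using s by (auto elim!: nonpos_Ints_cases)
    then have "Gamma (s + real j) = pochhammer s j * Gamma s"
      by (simp add: pochhammer_Gamma Gamma_eq_zero_iff)
    moreover have "x powr (- (s + real j)) = x powr (-s) / x ^ j"
      using x by (simp add: powr_diff powr_realpow)
    ultimately show ?thesis by (simp add: v_def mult_ac)
  qed
  have moment: "has_bochner_integral lborel
    (\<lambda>k. indicator {0<..} k * (k powr (q + \<alpha> * real j - 1) * exp (- x * k powr \<alpha>))) (v j)" for j
    using has_bochner_integral_powr_exp_neg_powr[of \<alpha> x "q + \<alpha> * real j"] assms x
    by (simp add: v_def s_def add_divide_distrib add_pos_nonneg)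
  have f_int: "has_bochner_integral lborel (f j) ((of_real x - z) ^ j / fact j * of_real (v j))" for j
    unfolding f_def by (intro has_bochner_integral_mult_right has_bochner_integral_of_real moment)
  have norm_f: "norm (f j k) = cmod (of_real x - z) ^ j / fact j *
      (indicator {0<..} k * (k powr (q + \<alpha> * real j - 1) * exp (- x * k powr \<alpha>)))" for j k
    by (simp add: f_def norm_mult norm_divide norm_power indicator_def)
  have "has_bochner_integral lborel (\<lambda>k. norm (f j k)) (cmod (of_real x - z) ^ j / fact j * v j)" for j
    unfolding norm_f by (intro has_bochner_integral_mult_right moment)
  then have int_norm: "(\<integral>k. norm (f j k) \<partial>lborel) = cmod (of_real x - z) ^ j / fact j * v j" for j
    by (simp add: has_bochner_integral_iff)
  \<comment> \<open>This identity serves twice: over the reals at \<open>cmod w\<close>, for the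
    norms, and over the complex numbers at \<open>w\<close>, for the value.\<close>
  have gbin: "(- a gchoose j) * (- y) ^ j = pochhammer a j / fact j * y ^ j" for a y :: "'b :: field_char_0" and j
    by (cases "even j") (simp_all add: gbinomial_pochhammer)
  \<comment> \<open>The integrals of the norms form the binomial series of
    \<open>(1 - cmod w) powr (-s)\<close>, convergent because \<open>cmod w < 1\<close>; this
    licenses the exchange of sum and integral.\<close>
  have "(\<lambda>j. Gamma s / \<alpha> * x powr (-s) * ((-s gchoose j) * (- cmod w) ^ j)) sums
      (Gamma s / \<alpha> * x powr (-s) * ((1 + - cmod w) powr (-s)))"
    using w by (intro sums_mult gen_binomial_real) auto
  moreover have "Gamma s / \<alpha> * x powr (-s) * ((-s gchoose j) * (- cmod w) ^ j) =
      cmod (of_real x - z) ^ j / fact j * v j" for j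
    using x by (simp add: v gbin w_def norm_divide power_divide mult_ac)
  ultimately have summ: "summable (\<lambda>j. \<integral>k. norm (f j k) \<partial>lborel)"
    unfolding int_norm by (simp only: sums_iff)
  have powr_split: "k powr (q + \<alpha> * real j - 1) = k powr (q - 1) * (k powr \<alpha>) ^ j" if "k > 0" for j k
    using that powr_add[of k "q - 1" "\<alpha> * real j"]
    by (simp add: powr_powr[symmetric] powr_realpow algebra_simps)
  have f_sums: "(\<lambda>j. f j k) sums
      (indicator {0<..} k *\<^sub>R (of_real (k powr (q - 1)) * exp (- z * of_real (k powr \<alpha>))))" for k
  proof (cases "k > 0")
    case True
    have "(\<lambda>j. ((of_real x - z) * of_real (k powr \<alpha>)) ^ j /\<^sub>R fact j) sums
        exp ((of_real x - z) * of_real (k powr \<alpha>))" by (rule exp_converges)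
    then have "(\<lambda>j. of_real (k powr (q - 1) * exp (- x * k powr \<alpha>)) * (((of_real x - z) * of_real (k powr \<alpha>)) ^ j /\<^sub>R fact j)) sums
        (of_real (k powr (q - 1) * exp (- x * k powr \<alpha>)) * exp ((of_real x - z) * of_real (k powr \<alpha>)))"
      by (rule sums_mult)
    moreover have "of_real (k powr (q - 1) * exp (- x * k powr \<alpha>)) * (((of_real x - z) * of_real (k powr \<alpha>)) ^ j /\<^sub>R fact j) = f j k" for j
    proof -
      show ?thesis using True powr_split[OF True, of j]
        by (simp add: f_def power_mult_distrib scaleR_conv_of_real divide_inverse mult_ac)
    qed
    moreover have "of_real (k powr (q - 1) * exp (- x * k powr \<alpha>)) * exp ((of_real x - z) * of_real (k powr \<alpha>))
        = indicator {0<..} k *\<^sub>R (of_real (k powr (q - 1)) * exp (- z * of_real (k powr \<alpha>)))"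
      using True by (simp add: exp_of_real[symmetric] exp_add[symmetric] algebra_simps
           del: exp_of_real)
    ultimately show ?thesis by simp
  qed (simp add: f_def)
  have "summable (\<lambda>j. norm (f j k))" for k
  proof (cases "k > 0")
    case True
    have "summable (\<lambda>j. k powr (q - 1) * exp (- x * k powr \<alpha>) * (inverse (fact j) * (cmod (of_real x - z) * k powr \<alpha>) ^ j))"
      by (intro summable_mult summable_exp)
    moreover have "k powr (q - 1) * exp (- x * k powr \<alpha>) * (inverse (fact j) * (cmod (of_real x - z) * k powr \<alpha>) ^ j) = norm (f j k)" for j
    proof -
      show ?thesis using True powr_split[OF True, of j] by (simp add: norm_f power_mult_distrib divide_inverse mult_ac)
    qed
    ultimately show ?thesis by (simp only:)
  qed (simp add: norm_f)
  then have ae: "AE k in lborel. summable (\<lambda>j. norm (f j k))" by simp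
  have fi: "integrable lborel (f j)" for j using f_int by (auto simp: has_bochner_integral_iff)
  note f_suminf = f_sums[THEN sums_unique, symmetric]
  have int: "integrable lborel (\<lambda>k. indicator {0<..} k *\<^sub>R (of_real (k powr (q - 1)) * exp (- z * of_real (k powr \<alpha>))))"
    using integrable_suminf[OF fi ae summ] by (simp only: f_suminf)
  have "(\<lambda>j. (of_real x - z) ^ j / fact j * of_real (v j)) sums
     (\<integral>k. indicator {0<..} k *\<^sub>R (of_real (k powr (q - 1)) * exp (- z * of_real (k powr \<alpha>))) \<partial>lborel)"
    using sums_integral[OF fi ae summ] f_int by (simp only: f_suminf has_bochner_integral_iff)
  moreover have "(\<lambda>j. of_real (Gamma s / \<alpha> * x powr (-s)) * ((of_real (-s) gchoose j) * (- w) ^ j)) sums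
      (of_real (Gamma s / \<alpha> * x powr (-s)) * ((1 + - w) powr (of_real (-s))))"
    using w by (intro sums_mult gen_binomial_complex) auto
  moreover have "of_real (Gamma s / \<alpha> * x powr (-s)) * ((of_real (-s) gchoose j) * (- w) ^ j) =
      (of_real x - z) ^ j / fact j * of_real (v j)" for j
    using x by (simp add: v gbin w_def power_divide pochhammer_of_real mult_ac)
  moreover have "of_real (Gamma s / \<alpha> * x powr (-s)) * ((1 + - w) powr (of_real (-s)))
      = of_real (Gamma s / \<alpha>) * z powr (- of_real s)"
  proof -
    have "1 + - w = z / of_real x" using x by (simp add: w_def field_simps)
    \<comment> \<open>Principal powers are not multiplicative in general; here one factor is a
      positive real.\<close>
    moreover have "(of_real x * (z / of_real x)) powr (- of_real s) =
        of_real x powr (- of_real s) * (z / of_real x) powr (- of_real s)"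
      using x by (intro powr_times_real_left) auto
    ultimately show ?thesis using x by (simp add: powr_of_real[symmetric])
  qed
  ultimately show ?thesis
    using int sums_unique2 by (fastforce simp: has_bochner_integral_iff s_def)
qed

text \<open>Because \<open>\<alpha> > 1\<close>, half of \<open>c * k powr \<alpha>\<close> absorbs
  the linear term up to an additive constant, and the other half remains as an integrable
  majorant.\<close>

lemma integrable_exp_linear_minus_powr:
  fixes \<alpha> c R :: real
  assumes "1 < \<alpha>" "0 < c"
  shows "integrable lborel (\<lambda>k. indicator {0<..} k * exp (R * k - c * k powr \<alpha>))"
proof -
  \<comment> \<open>The point where \<open>\<bar>R\<bar> * k\<close> and
    \<open>c / 2 * k powr \<alpha>\<close> balance; beyond it the power dominates.\<close>
  define K where "K = (2 * \<bar>R\<bar> / c) powr (1 / (\<alpha> - 1))"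
  have bound: "R * k \<le> \<bar>R\<bar> * K + c / 2 * k powr \<alpha>" if "k > 0" for k
  proof (cases "k \<le> K")
    case True
    have "R * k \<le> \<bar>R\<bar> * K" using that True by (intro mult_mono) auto
    then show ?thesis using assms by (simp add: add_increasing2)
  next
    case False
    have "2 * \<bar>R\<bar> / c = K powr (\<alpha> - 1)"
      using assms by (simp add: K_def powr_powr)
    also have "\<dots> \<le> k powr (\<alpha> - 1)"
      using False assms by (intro powr_mono2) (auto simp: K_def)
    finally have "\<bar>R\<bar> \<le> c / 2 * k powr (\<alpha> - 1)" using assms by (simp add: field_simps)
    then have "\<bar>R\<bar> * k \<le> c / 2 * k powr (\<alpha> - 1) * k" using that by simp
    also have "\<dots> = c / 2 * k powr \<alpha>" using that powr_add[of k "\<alpha> - 1" 1] by simp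
    finally have "\<bar>R\<bar> * k \<le> c / 2 * k powr \<alpha>" .
    moreover have "R * k \<le> \<bar>R\<bar> * k" using that by simp
    moreover have "0 \<le> \<bar>R\<bar> * K" by (simp add: K_def)
    ultimately show ?thesis by linarith
  qed
  have "integrable lborel (\<lambda>k. exp (\<bar>R\<bar> * K) * (indicator {0<..} k * (k powr (1 - 1) * exp (- (c / 2) * k powr \<alpha>))))"
    using has_bochner_integral_powr_exp_neg_powr[of \<alpha> "c / 2" 1] assms
    by (intro integrable_mult_right) (auto simp: has_bochner_integral_iff)
  then show ?thesis
  proof (rule Bochner_Integration.integrable_bound)
    have "R * k - c * k powr \<alpha> \<le> \<bar>R\<bar> * K - c / 2 * k powr \<alpha>" if "k > 0" for k
      using bound[OF that] by (simp add: field_simps)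
    then show "AE k in lborel. norm (indicator {0<..} k * exp (R * k - c * k powr \<alpha>)) \<le>
        norm (exp (\<bar>R\<bar> * K) * (indicator {0<..} k * (k powr (1 - 1) * exp (- (c / 2) * k powr \<alpha>))))"
      by (auto simp: indicator_def exp_add[symmetric])
  qed auto
qed

text \<open>The summands are the integrals of the exponential series of \<open>R * k\<close> against
  \<open>exp (- c * k powr \<alpha>)\<close>. Their partial sums are bounded by the integral of the
  full exponential, so no asymptotics of \<open>Gamma\<close> enter.\<close>

lemma summable_power_Gamma_div_fact:
  fixes \<alpha> c R :: real
  assumes "1 < \<alpha>" "0 < c" "0 \<le> R"
  shows "summable (\<lambda>n. R ^ n / fact n * (Gamma (real (Suc n) / \<alpha>) / \<alpha> * c powr (- (real (Suc n) / \<alpha>))))"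
proof -
  define f where "f = (\<lambda>n k. R ^ n / fact n *
     (indicator {0<..} k * (k powr (real (Suc n) - 1) * exp (- c * k powr \<alpha>))))"
  have f: "has_bochner_integral lborel (f n) (R ^ n / fact n * (Gamma (real (Suc n) / \<alpha>) / \<alpha> * c powr (- (real (Suc n) / \<alpha>))))" for n
    unfolding f_def using assms
    by (intro has_bochner_integral_mult_right has_bochner_integral_powr_exp_neg_powr) auto
  then have fi: "integrable lborel (f n)" for n by (auto simp: has_bochner_integral_iff)
  have "summable (\<lambda>n. \<integral>k. f n k \<partial>lborel)"
  proof (rule bounded_imp_summable)
    show "0 \<le> (\<integral>k. f n k \<partial>lborel)" for n
      using assms by (intro integral_nonneg_AE) (auto simp: f_def)
    fix N
    have "(\<Sum>n\<le>N. \<integral>k. f n k \<partial>lborel) = (\<integral>k. (\<Sum>n\<le>N. f n k) \<partial>lborel)"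
      by (intro Bochner_Integration.integral_sum[symmetric] fi)
    also have "\<dots> \<le> (\<integral>k. indicator {0<..} k * exp (R * k - c * k powr \<alpha>) \<partial>lborel)"
    proof (rule integral_mono)
      show "integrable lborel (\<lambda>k. \<Sum>n\<le>N. f n k)" by (intro Bochner_Integration.integrable_sum fi)
      show "integrable lborel (\<lambda>k. indicator {0<..} k * exp (R * k - c * k powr \<alpha>))"
        using assms by (intro integrable_exp_linear_minus_powr)
      show "(\<Sum>n\<le>N. f n k) \<le> indicator {0<..} k * exp (R * k - c * k powr \<alpha>)" for k
      proof (cases "k > 0")
        case True
        have "(\<Sum>n\<le>N. inverse (fact n) * (R * k) ^ n) \<le> (\<Sum>n. inverse (fact n) * (R * k) ^ n)"
          using assms True by (intro sum_le_suminf summable_exp) auto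
        also have "\<dots> = exp (R * k)" by (simp add: exp_def)
        finally have "(\<Sum>n\<le>N. inverse (fact n) * (R * k) ^ n) * exp (- c * k powr \<alpha>) \<le> exp (R * k) * exp (- c * k powr \<alpha>)"
          by (intro mult_right_mono) auto
        also have "(\<Sum>n\<le>N. inverse (fact n) * (R * k) ^ n) * exp (- c * k powr \<alpha>) = (\<Sum>n\<le>N. f n k)"
          unfolding sum_distrib_right using True
          by (intro sum.cong refl) (simp add: f_def powr_realpow divide_inverse power_mult_distrib mult_ac)
        also have "exp (R * k) * exp (- c * k powr \<alpha>) = exp (R * k - c * k powr \<alpha>)"
          by (simp add: exp_add[symmetric])
        finally show ?thesis using True by simp
      qed (simp add: f_def)
    qed
    finally show "(\<Sum>n\<le>N. \<integral>k. f n k \<partial>lborel) \<le> (\<integral>k. indicator {0<..} k * exp (R * k - c * k powr \<alpha>) \<partial>lborel)" .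
  qed
  then show ?thesis using f by (simp only: has_bochner_integral_iff)
qed

text \<open>Reduces integrals over the line to the half-line, where the Gamma integrals apply; the
  origin is a null set.\<close>

lemma has_bochner_integral_lborel_split_at_0:
  fixes h :: "real \<Rightarrow> 'a :: {banach, second_countable_topology}"
  assumes "has_bochner_integral lborel (\<lambda>t. indicator {0<..} t *\<^sub>R h t) I"
    and "has_bochner_integral lborel (\<lambda>t. indicator {0<..} t *\<^sub>R h (- t)) J"
    and [measurable]: "h \<in> borel_measurable borel"
  shows "has_bochner_integral lborel h (I + J)"
proof -
  have "has_bochner_integral lborel (\<lambda>t. indicator {0<..} (- t) *\<^sub>R h t) J"
    using lborel_has_bochner_integral_real_affine_iff[of "-1" "\<lambda>t. indicator {0<..} t *\<^sub>R h (- t)" J 0] assms(2)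
    by simp
  from has_bochner_integral_add[OF assms(1) this]
  show ?thesis
  proof (rule has_bochner_integralI_AE)
    have "AE t in lborel. t \<noteq> (0::real)" by (rule AE_lborel_singleton)
    then show "AE t in lborel. indicator {0<..} t *\<^sub>R h t + indicator {0<..} (- t) *\<^sub>R h t = h t"
      by eventually_elim (auto simp: indicator_def)
  qed auto
qed

text \<open>Euler's reflection formula. With \<open>rGamma\<close> on the right it also covers
  positive integers \<open>s\<close>, where both sides vanish; this is the convention
  \<open>1 / Gamma = 0\<close> at the poles.\<close>

lemma Gamma_mult_sin_pi:
  fixes s :: real
  assumes "0 < s"
  shows "Gamma s * sin (pi * s) = pi * rGamma (1 - s)"
proof -
  have "complex_of_real (rGamma s * rGamma (1 - s)) = complex_of_real (sin (pi * s) / pi)"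
    using rGamma_reflection_complex[of "of_real s"] rGamma_complex_of_real[of "1 - s"]
    by (simp add: rGamma_complex_of_real sin_of_real[symmetric] del: sin_of_real)
  then have "rGamma s * rGamma (1 - s) = sin (pi * s) / pi"
    by (simp only: of_real_eq_iff)
  moreover have "Gamma s * rGamma s = 1"
    using assms by (simp add: Gamma_def rGamma_eq_zero_iff nonpos_Ints_def)
  moreover have "Gamma s * sin (pi * s) = pi * (Gamma s * (sin (pi * s) / pi))" by simp
  ultimately show ?thesis by (metis mult.assoc mult_1)
qed

subsection \<open>Moments of the stable characteristic function\<close>

text \<open>\<open>A\<close> stands for \<open>\<tau> * \<sigma> powr \<alpha>\<close>. For
  \<open>t > 0\<close> this is the exponential of \<open>- \<zeta> * t powr \<alpha>\<close> with a
  complex rate \<open>\<zeta>\<close> of real part \<open>A\<close>.\<close>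

definition stable_char :: "real \<Rightarrow> real \<Rightarrow> real \<Rightarrow> complex" where
  "stable_char \<alpha> A t = exp (- complex_of_real (A * \<bar>t\<bar> powr \<alpha>) * (1 + \<i> * complex_of_real (tan (\<alpha> * pi / 2) * sgn t)))"

lemma stable_char_measurable [measurable]: "stable_char \<alpha> A \<in> borel_measurable borel"
proof -
  have [measurable]: "(sgn :: real \<Rightarrow> real) \<in> borel_measurable borel"
    unfolding sgn_if[abs_def] by measurable
  show ?thesis unfolding stable_char_def[abs_def] by measurable
qed

lemma norm_stable_char: "norm (stable_char \<alpha> A t) = exp (- A * \<bar>t\<bar> powr \<alpha>)"
  by (simp add: stable_char_def)

lemma stable_char_pos:
  "t > 0 \<Longrightarrow> stable_char \<alpha> A t = exp (- (of_real A * (1 + \<i> * tan (\<alpha> * pi / 2))) * of_real (t powr \<alpha>))"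
  by (simp add: stable_char_def algebra_simps)

lemma stable_char_uminus: "stable_char \<alpha> A (- t) = cnj (stable_char \<alpha> A t)"
  by (simp add: stable_char_def exp_cnj sgn_minus)

text \<open>The modulus sees only the real part \<open>A\<close> of the rate, so the real-rate
  integral applies on each half-line. These absolute moments later justify termwise
  integration.\<close>

lemma has_bochner_integral_power_norm_stable_char:
  assumes "1 < \<alpha>" "0 < A"
  shows "has_bochner_integral lborel (\<lambda>t. norm ((- \<i> * of_real t) ^ n * stable_char \<alpha> A t))
     (2 * (Gamma (real (Suc n) / \<alpha>) / \<alpha> * A powr (- (real (Suc n) / \<alpha>))))"
proof -
  let ?h = "\<lambda>t. norm ((- \<i> * of_real t) ^ n * stable_char \<alpha> A t)"
  let ?I = "Gamma (real (Suc n) / \<alpha>) / \<alpha> * A powr (- (real (Suc n) / \<alpha>))"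
  have I: "has_bochner_integral lborel (\<lambda>t. indicator {0<..} t *\<^sub>R ?h t) ?I"
  proof -
    have eq: "(\<lambda>t. indicator {0<..} t *\<^sub>R ?h t) =
        (\<lambda>t. indicator {0<..} t * (t powr (real (Suc n) - 1) * exp (- A * t powr \<alpha>)))"
      by (auto simp: fun_eq_iff indicator_def norm_mult norm_power norm_stable_char powr_realpow)
    show ?thesis
      unfolding eq using assms by (intro has_bochner_integral_powr_exp_neg_powr) auto
  qed
  have "?h (- t) = ?h t" for t
    by (simp add: norm_mult norm_power norm_stable_char)
  then have J: "has_bochner_integral lborel (\<lambda>t. indicator {0<..} t *\<^sub>R ?h (- t)) ?I"
    using I by simp
  show ?thesis
    using has_bochner_integral_lborel_split_at_0[OF I J] by simp
qed

text \<open>Rests on \<open>1 + \<i> * tan x = exp (\<i> * x) / cos x\<close> at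
  \<open>x = pi * \<alpha> / 2\<close>. There the cosine is negative; its sign is absorbed by
  turning the angle through \<open>- pi\<close>, which also brings it into the range from
  \<open>- pi / 2\<close> to 0. With \<open>A = \<tau> * \<sigma> powr \<alpha>\<close> the modulus
  \<open>c\<close> is \<open>- \<mu> * \<tau>\<close>.\<close>

lemma stable_exponent_polar:
  assumes "1 < \<alpha>" "\<alpha> \<le> 2" "0 < A"
  defines "c \<equiv> - A / cos (pi * \<alpha> / 2)"
  shows "0 < c"
    and "of_real A * (1 + \<i> * tan (\<alpha> * pi / 2)) = of_real c * exp (\<i> * of_real (pi * (\<alpha> / 2 - 1)))"
proof -
  have "cos (pi * \<alpha> / 2) < 0"
    using assms cos_monotone_0_pi[of "pi / 2" "pi * \<alpha> / 2"] by (simp add: field_simps)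
  then show "0 < c" using assms by (simp add: c_def divide_less_0_iff)
  have *: "cos (pi * (\<alpha> / 2 - 1)) = - cos (pi * \<alpha> / 2)" "sin (pi * (\<alpha> / 2 - 1)) = - sin (pi * \<alpha> / 2)"
    using cos_minus_pi[of "pi * \<alpha> / 2"] sin_minus_pi[of "pi * \<alpha> / 2"] by (simp_all add: algebra_simps)
  show "of_real A * (1 + \<i> * tan (\<alpha> * pi / 2)) = of_real c * exp (\<i> * of_real (pi * (\<alpha> / 2 - 1)))"
    using \<open>cos (pi * \<alpha> / 2) < 0\<close> unfolding cis_conv_exp[symmetric]
    by (simp add: complex_eq_iff * c_def tan_def mult.commute[of \<alpha> pi])
qed

text \<open>The two half-lines contribute complex conjugates, so the integral is twice a real part.
  The phase of that term produces \<open>sin (pi * s)\<close>, which the reflection formula merges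
  with \<open>Gamma s\<close>.\<close>

lemma has_bochner_integral_power_stable_char:
  assumes "1 < \<alpha>" "\<alpha> \<le> 2" "0 < A"
  defines "c \<equiv> - A / cos (pi * \<alpha> / 2)"
  shows "has_bochner_integral lborel (\<lambda>t. (- \<i> * of_real t) ^ n * stable_char \<alpha> A t)
     (of_real (2 * pi * ((- 1) ^ n * rGamma (1 - real (Suc n) / \<alpha>) / \<alpha> * c powr (- (real (Suc n) / \<alpha>)))))"
proof -
  define s where "s = real (Suc n) / \<alpha>"
  define \<theta> where "\<theta> = pi * (\<alpha> / 2 - 1)"
  define \<zeta> where "\<zeta> = of_real A * (1 + \<i> * tan (\<alpha> * pi / 2))"
  have s: "s > 0" using assms by (simp add: s_def)
  have c: "c > 0" and \<zeta>: "\<zeta> = of_real c * exp (\<i> * of_real \<theta>)"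
    using stable_exponent_polar[OF assms(1-3)] by (simp_all add: c_def \<zeta>_def \<theta>_def)
  have \<theta>: "-pi < \<theta>" "\<theta> \<le> 0"
    using assms by (auto simp: \<theta>_def mult_le_0_iff right_diff_distrib)
  let ?h = "\<lambda>t. (- \<i> * of_real t) ^ n * stable_char \<alpha> A t"
  define I where "I = (- \<i>) ^ n * (of_real (Gamma s / \<alpha>) * \<zeta> powr (- of_real s))"
  have I: "has_bochner_integral lborel (\<lambda>t. indicator {0<..} t *\<^sub>R ?h t) I"
  proof -
    have "(- \<i>) ^ n * indicator {0<..} t *\<^sub>R (of_real (t powr (real (Suc n) - 1)) * exp (- \<zeta> * of_real (t powr \<alpha>)))
        = indicator {0<..} t *\<^sub>R ?h t" for t
      by (cases "t > 0") (simp_all add: \<zeta>_def stable_char_pos powr_realpow flip: power_mult_distrib)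
    note eq = this
    have "has_bochner_integral lborel (\<lambda>t. (- \<i>) ^ n * indicator {0<..} t *\<^sub>R (of_real (t powr (real (Suc n) - 1)) * exp (- \<zeta> * of_real (t powr \<alpha>)))) I"
      unfolding I_def s_def using assms
      by (intro has_bochner_integral_mult_right has_bochner_integral_powr_exp_neg_powr_complex) (auto simp: \<zeta>_def)
    then show ?thesis unfolding eq .
  qed
  have "?h (- t) = cnj (?h t)" for t
    by (simp add: stable_char_uminus)
  then have eq: "indicator {0<..} t *\<^sub>R ?h (- t) = cnj (indicator {0<..} t *\<^sub>R ?h t)" for t
    by simp
  have J: "has_bochner_integral lborel (\<lambda>t. indicator {0<..} t *\<^sub>R ?h (- t)) (cnj I)"
    unfolding eq by (rule has_bochner_integral_cnj[OF I])
  have "has_bochner_integral lborel ?h (I + cnj I)"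
    by (rule has_bochner_integral_lborel_split_at_0[OF I J]) measurable
  moreover have "Re I = pi * ((- 1) ^ n * rGamma (1 - s) / \<alpha> * c powr (- s))"
  proof -
    \<comment> \<open>The bounds on \<open>\<theta>\<close> place it in the principal range, so
      \<open>Ln\<close> returns exactly this angle.\<close>
    have "Ln \<zeta> = of_real (ln c) + \<i> * of_real \<theta>"
      unfolding \<zeta> using c \<theta> pi_gt_zero by (subst Ln_times_of_real) (auto simp: Ln_exp Ln_of_real)
    then have "\<zeta> powr (- of_real s) = exp (of_real (- s * ln c) + \<i> * of_real (- s * \<theta>))"
      using c by (simp add: powr_def \<zeta> algebra_simps)
    also have "\<dots> = of_real (c powr (- s)) * cis (- s * \<theta>)"
      using c unfolding exp_add cis_conv_exp exp_of_real by (simp add: powr_def)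
    finally have 1: "\<zeta> powr (- of_real s) = of_real (c powr (- s)) * cis (- s * \<theta>)" .
    have "- \<i> = cis (- pi / 2)" by (simp add: complex_eq_iff)
    then have "(- \<i>) ^ n = cis (- pi / 2) ^ n" by simp
    also have "\<dots> = cis (real n * (- pi / 2))" by (rule Complex.DeMoivre)
    finally have "(- \<i>) ^ n * cis (- s * \<theta>) = cis (real n * (- pi / 2) + - s * \<theta>)"
      by (simp only: cis_mult)
    \<comment> \<open>As \<open>\<alpha> * s = n + 1\<close>, the part of
      \<open>- s * \<theta>\<close> containing \<open>\<alpha>\<close> consists of
      \<open>n + 1\<close> negative quarter turns, which join the \<open>n\<close> quarter turns of
      \<open>(- \<i>) ^ n\<close>.\<close>
    also have "real n * (- pi / 2) + - s * \<theta> = pi * s - pi / 2 - real n * pi"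
      using assms by (simp add: s_def \<theta>_def field_simps)
    finally have "Re ((- \<i>) ^ n * cis (- s * \<theta>)) = cos (pi * s - pi / 2 - real n * pi)"
      by simp
    also have "\<dots> = (- 1) ^ n * sin (pi * s)"
      by (simp add: cos_diff sin_diff)
    finally have Re_w: "Re ((- \<i>) ^ n * cis (- s * \<theta>)) = (- 1) ^ n * sin (pi * s)" .
    have I_eq: "I = of_real (Gamma s / \<alpha> * c powr (- s)) * ((- \<i>) ^ n * cis (- s * \<theta>))"
      by (simp add: I_def 1)
    have Re_of_real_mult: "Re (of_real x * w) = x * Re w" for x w by simp
    have "Re I = Gamma s / \<alpha> * c powr (- s) * ((- 1) ^ n * sin (pi * s))"
      unfolding I_eq Re_of_real_mult Re_w ..
    then show ?thesis using Gamma_mult_sin_pi[OF s] by simp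
  qed
  ultimately show ?thesis by (simp add: complex_add_cnj s_def mult_ac)
qed

subsection \<open>Entire densities by Fourier inversion\<close>

text \<open>The numbers \<open>d n\<close> turn out to be the derivatives of the density at \<open>0\<close>.\<close>

locale exp_integrable_char = real_distribution P for P +
  fixes d :: "nat \<Rightarrow> real"
  assumes char_moment: "\<And>n. has_bochner_integral lborel
      (\<lambda>t. (- \<i> * of_real t) ^ n * char P t) (of_real (2 * pi * d n))"
    and char_exp_moment: "\<And>R. 0 \<le> R \<Longrightarrow>
      summable (\<lambda>n. R ^ n / fact n * (\<integral>t. norm ((- \<i> * of_real t) ^ n * char P t) \<partial>lborel))"
begin

definition taylor_density :: "real \<Rightarrow> real" where
  "taylor_density x = (\<Sum>n. d n / fact n * x ^ n)"

text \<open>The termwise primitive that vanishes at 0. It agrees with the distribution function only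
  up to an additive constant, so only its increments are used.\<close>

definition taylor_cdf :: "real \<Rightarrow> real" where
  "taylor_cdf x = (\<Sum>n. d n / fact (Suc n) * x ^ Suc n)"

text \<open>Each \<open>d n\<close> is bounded by the absolute moment of the same order, so
  \<open>char_exp_moment\<close> with \<open>R = \<bar>x\<bar>\<close> gives absolute convergence at
  every \<open>x\<close>.\<close>

lemma summable_norm_taylor_density:
  "summable (\<lambda>n. norm (d n / fact n * x ^ n))"
proof (rule summable_comparison_test')
  show "summable (\<lambda>n. \<bar>x\<bar> ^ n / fact n * (\<integral>t. norm ((- \<i> * of_real t) ^ n * char P t) \<partial>lborel))"
    by (rule char_exp_moment) simp
  fix n
  have "2 * pi * \<bar>d n\<bar> = norm (\<integral>t. (- \<i> * of_real t) ^ n * char P t \<partial>lborel)"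
    using char_moment[of n] by (simp add: has_bochner_integral_iff norm_mult)
  also have "\<dots> \<le> (\<integral>t. norm ((- \<i> * of_real t) ^ n * char P t) \<partial>lborel)"
    by (rule integral_norm_bound)
  finally have "\<bar>d n\<bar> * (2 * pi) \<le> (\<integral>t. norm ((- \<i> * of_real t) ^ n * char P t) \<partial>lborel)"
    by (simp add: mult_ac)
  moreover have "\<bar>d n\<bar> * 1 \<le> \<bar>d n\<bar> * (2 * pi)"
    using pi_ge_two by (intro mult_left_mono) auto
  ultimately have "\<bar>x\<bar> ^ n / fact n * \<bar>d n\<bar> \<le> \<bar>x\<bar> ^ n / fact n * (\<integral>t. norm ((- \<i> * of_real t) ^ n * char P t) \<partial>lborel)"
    by (intro mult_left_mono) auto
  then show "norm (norm (d n / fact n * x ^ n)) \<le> \<bar>x\<bar> ^ n / fact n * (\<integral>t. norm ((- \<i> * of_real t) ^ n * char P t) \<partial>lborel)"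
    by (simp add: abs_mult power_abs mult_ac)
qed

lemma taylor_density_sums: "(\<lambda>n. d n / fact n * x ^ n) sums taylor_density x"
  unfolding taylor_density_def
  by (rule summable_sums[OF summable_norm_cancel[OF summable_norm_taylor_density]])

lemma summable_taylor_cdf: "summable (\<lambda>n. d n / fact (Suc n) * x ^ Suc n)"
proof (rule summable_comparison_test')
  show "summable (\<lambda>n. \<bar>x\<bar> * norm (d n / fact n * x ^ n))"
    by (intro summable_mult summable_norm_taylor_density)
  fix n
  have "\<bar>d n\<bar> * \<bar>x\<bar> ^ Suc n / fact (Suc n) \<le> \<bar>d n\<bar> * \<bar>x\<bar> ^ Suc n / fact n"
    by (intro divide_left_mono fact_mono mult_nonneg_nonneg) auto
  then show "norm (d n / fact (Suc n) * x ^ Suc n) \<le> \<bar>x\<bar> * norm (d n / fact n * x ^ n)"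
    by (simp add: abs_mult power_abs mult_ac del: fact_Suc)
qed

lemma DERIV_taylor_cdf: "(taylor_cdf has_real_derivative taylor_density x) (at x)"
proof -
  \<comment> \<open>The coefficients of \<open>taylor_cdf\<close> as an ordinary power series with
    zero constant term, so that \<open>diffs e\<close> returns the coefficients of
    \<open>taylor_density\<close>.\<close>
  define e where "e = (\<lambda>n. case n of 0 \<Rightarrow> 0 | Suc m \<Rightarrow> d m / fact (Suc m))"
  have "summable (\<lambda>n. e (Suc n) * x ^ Suc n)" for x
    using summable_taylor_cdf[of x] by (simp add: e_def del: fact_Suc)
  then have summ: "summable (\<lambda>n. e n * x ^ n)" for x
    by (rule summable_Suc_iff[THEN iffD1])
  have "taylor_cdf = (\<lambda>x. \<Sum>n. e n * x ^ n)"
    using suminf_split_head[OF summ] by (simp add: fun_eq_iff taylor_cdf_def e_def del: fact_Suc)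
  moreover have "taylor_density x = (\<Sum>n. diffs e n * x ^ n)" for x
    by (simp add: taylor_density_def diffs_def e_def)
  ultimately show ?thesis
    using termdiffs_strong_converges_everywhere[OF summ, of x] by simp
qed

lemma taylor_density_measurable [measurable]: "taylor_density \<in> borel_measurable borel"
proof -
  have "taylor_density = (\<lambda>x. \<Sum>n. d n / fact n * x ^ n)" by (rule ext) (rule taylor_density_def)
  then show ?thesis by simp
qed

text \<open>The kernel of Levy's inversion formula is expanded in powers of \<open>t\<close> and
  integrated term by term with \<open>char_moment\<close>. The conditions on the endpoints come from
  the inversion formula and are removed afterwards.\<close>

lemma measure_Ioc_nonatoms:
  assumes "a \<le> b" "measure P {a} = 0" "measure P {b} = 0"
  shows "measure P {a<..b} = taylor_cdf b - taylor_cdf a"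
proof -
  define \<phi> where "\<phi> = char P"
  define F where "F = (\<lambda>t. (iexp (-(t * a)) - iexp (-(t * b))) / (\<i> * of_real t) * \<phi> t)"
  \<comment> \<open>The coefficient of \<open>(- \<i> * t) ^ n\<close> in the inversion
    kernel.\<close>
  define \<gamma> where "\<gamma> = (\<lambda>n. (b ^ Suc n - a ^ Suc n) / fact (Suc n))"
  define g where "g = (\<lambda>n t. of_real (\<gamma> n) * ((- \<i> * of_real t) ^ n * \<phi> t))"
  define R where "R = max \<bar>a\<bar> \<bar>b\<bar>"
  have R: "R \<ge> 0" "\<bar>a\<bar> \<le> R" "\<bar>b\<bar> \<le> R" by (auto simp: R_def)
  have \<gamma>: "\<bar>\<gamma> n\<bar> \<le> 2 * R * (R ^ n / fact n)" for n
  proof -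
    have "\<bar>b ^ Suc n - a ^ Suc n\<bar> \<le> \<bar>b\<bar> ^ Suc n + \<bar>a\<bar> ^ Suc n"
      using abs_triangle_ineq4 by (metis power_abs)
    also have "\<dots> \<le> R ^ Suc n + R ^ Suc n"
      using R by (intro add_mono power_mono) auto
    finally have "\<bar>\<gamma> n\<bar> \<le> (2 * R ^ Suc n) / fact (Suc n)"
      unfolding \<gamma>_def abs_divide abs_of_pos[OF fact_gt_zero] by (intro divide_right_mono) auto
    also have "\<dots> \<le> (2 * R ^ Suc n) / fact n"
      using R by (intro divide_left_mono fact_mono mult_nonneg_nonneg) auto
    finally show ?thesis by (simp add: mult_ac)
  qed
  have g: "has_bochner_integral lborel (g n) (of_real (\<gamma> n) * of_real (2 * pi * d n))" for n
    unfolding g_def \<phi>_def by (intro has_bochner_integral_mult_right char_moment)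
  then have gi: "integrable lborel (g n)" for n by (auto simp: has_bochner_integral_iff)
  have "summable (\<lambda>n. norm (g n t))" for t
  proof (rule summable_comparison_test')
    show "summable (\<lambda>n. 2 * R * norm (\<phi> t) * (inverse (fact n) * (R * \<bar>t\<bar>) ^ n))"
      by (intro summable_mult summable_exp)
    fix n
    have "norm (g n t) = \<bar>\<gamma> n\<bar> * (\<bar>t\<bar> ^ n * norm (\<phi> t))"
      by (simp add: g_def norm_mult norm_power)
    also have "\<dots> \<le> 2 * R * (R ^ n / fact n) * (\<bar>t\<bar> ^ n * norm (\<phi> t))"
      by (intro mult_right_mono \<gamma>) auto
    finally show "norm (norm (g n t)) \<le> 2 * R * norm (\<phi> t) * (inverse (fact n) * (R * \<bar>t\<bar>) ^ n)"
      by (simp add: power_mult_distrib divide_inverse mult_ac)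
  qed
  then have ae: "AE t in lborel. summable (\<lambda>n. norm (g n t))" by simp
  have summ: "summable (\<lambda>n. \<integral>t. norm (g n t) \<partial>lborel)"
  proof (rule summable_comparison_test')
    show "summable (\<lambda>n. 2 * R * (R ^ n / fact n * (\<integral>t. norm ((- \<i> * of_real t) ^ n * char P t) \<partial>lborel)))"
      using R by (intro summable_mult char_exp_moment)
    fix n
    have "(\<integral>t. norm (g n t) \<partial>lborel) = \<bar>\<gamma> n\<bar> * (\<integral>t. norm ((- \<i> * of_real t) ^ n * char P t) \<partial>lborel)"
      unfolding g_def norm_mult[of "of_real (\<gamma> n)"] \<phi>_def by simp
    also have "\<dots> \<le> 2 * R * (R ^ n / fact n) * (\<integral>t. norm ((- \<i> * of_real t) ^ n * char P t) \<partial>lborel)"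
      by (intro mult_right_mono \<gamma>) auto
    finally show "norm (\<integral>t. norm (g n t) \<partial>lborel) \<le> 2 * R * (R ^ n / fact n * (\<integral>t. norm ((- \<i> * of_real t) ^ n * char P t) \<partial>lborel))"
      by (simp add: mult_ac)
  qed
  have g_sums: "(\<lambda>n. g n t) sums F t" if "t \<noteq> 0" for t
  proof -
    have "(\<lambda>n. (\<i> * of_real (-(t * a))) ^ n /\<^sub>R fact n - (\<i> * of_real (-(t * b))) ^ n /\<^sub>R fact n) sums
        (iexp (-(t * a)) - iexp (-(t * b)))" (is "?s sums _")
      by (intro sums_diff exp_converges)
    \<comment> \<open>The constant terms of the two exponentials cancel, so the series starts at
      index 1 and can be divided by \<open>\<i> * t\<close>.\<close>
    then have "(\<lambda>n. ?s (Suc n)) sums (iexp (-(t * a)) - iexp (-(t * b)))"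
      by (subst sums_Suc_iff) simp
    then have "(\<lambda>n. ?s (Suc n) / (\<i> * of_real t) * \<phi> t) sums F t"
      unfolding F_def by (intro sums_mult2 sums_divide)
    moreover have "?s (Suc n) / (\<i> * of_real t) * \<phi> t = g n t" for n
    proof -
      have arg: "\<i> * of_real (-(t * x)) = of_real x * (- \<i> * of_real t)" for x by simp
      have "?s (Suc n) = - of_real (\<gamma> n) * (- \<i> * of_real t) ^ Suc n"
        unfolding \<gamma>_def arg[of a] arg[of b] power_mult_distrib
        by (simp add: scaleR_conv_of_real divide_inverse algebra_simps del: power_Suc fact_Suc)
      also have "\<dots> / (\<i> * of_real t) = of_real (\<gamma> n) * (- \<i> * of_real t) ^ n"
        using that by (simp add: field_simps)
      finally show ?thesis by (simp add: g_def)
    qed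
    ultimately show ?thesis by simp
  qed
  \<comment> \<open>At \<open>t = 0\<close> the division by zero makes \<open>F\<close> vanish while
    the series equals \<open>b - a\<close>; a single point is null.\<close>
  have AE_eq: "AE t in lborel. (\<Sum>n. g n t) = F t"
    using AE_lborel_singleton[of 0] by eventually_elim (simp add: g_sums[THEN sums_unique, symmetric])
  have [measurable]: "\<phi> \<in> borel_measurable borel"
    unfolding \<phi>_def by (intro borel_measurable_continuous_onI continuous_at_imp_continuous_on ballI isCont_char)
  have [measurable]: "F \<in> borel_measurable borel" unfolding F_def by measurable
  have gm [measurable]: "g n \<in> borel_measurable borel" for n unfolding g_def by measurable
  have Fi: "integrable lborel F"
    using integrable_suminf[OF gi ae summ] by (rule integrable_cong_AE_imp) (use AE_eq in auto)
  have "(\<integral>t. F t \<partial>lborel) = (\<integral>t. (\<Sum>n. g n t) \<partial>lborel)"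
    using AE_eq by (intro integral_cong_AE) auto
  then have F_sums: "(\<lambda>n. of_real (\<gamma> n) * of_real (2 * pi * d n)) sums (\<integral>t. F t \<partial>lborel)"
    using sums_integral[OF gi ae summ] g by (simp only: has_bochner_integral_iff)
  \<comment> \<open>Levy's formula is a limit of truncated integrals; as \<open>F\<close> is
    integrable, dominated convergence identifies that limit with the full integral.\<close>
  have "(\<lambda>T. CLBINT t=-real T..real T. F t) \<longlonglongrightarrow> (\<integral>t. F t \<partial>lborel)"
  proof -
    have "(\<lambda>T. \<integral>t. indicator {- real T<..<real T} t *\<^sub>R F t \<partial>lborel) \<longlonglongrightarrow> (\<integral>t. F t \<partial>lborel)"
    proof (rule integral_dominated_convergence[where w = "\<lambda>t. norm (F t)"])
      show "AE t in lborel. (\<lambda>T. indicator {- real T<..<real T} t *\<^sub>R F t) \<longlonglongrightarrow> F t"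
      proof (rule AE_I2, rule tendsto_eventually)
        fix t :: real
        obtain N :: nat where "\<bar>t\<bar> < real N" using reals_Archimedean2 by blast
        then show "\<forall>\<^sub>F T in sequentially. indicator {- real T<..<real T} t *\<^sub>R F t = F t"
          by (intro eventually_sequentiallyI[of N]) (auto simp: indicator_def)
      qed
      show "AE t in lborel. norm (indicator {- real T<..<real T} t *\<^sub>R F t) \<le> norm (F t)" for T
        by (auto simp: indicator_def)
    qed (use Fi in auto)
    then show ?thesis
      by (simp add: interval_lebesgue_integral_def set_lebesgue_integral_def einterval_eq)
  qed
  then have "(\<lambda>T. 1 / (2 * pi) * (CLBINT t=-real T..real T. F t)) \<longlonglongrightarrow> 1 / (2 * pi) * (\<integral>t. F t \<partial>lborel)"
    by (intro tendsto_mult_left) auto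
  moreover have "(\<lambda>T. 1 / (2 * pi) * (CLBINT t=-real T..real T. F t)) \<longlonglongrightarrow> of_real (measure P {a<..b})"
    using Levy_Inversion[OF assms] unfolding F_def \<phi>_def by simp
  ultimately have "of_real (measure P {a<..b}) = 1 / (2 * pi) * (\<integral>t. F t \<partial>lborel)"
    by (rule LIMSEQ_unique[rotated])
  moreover have "(\<lambda>n. complex_of_real (1 / (2 * pi)) * (of_real (\<gamma> n) * of_real (2 * pi * d n))) sums (1 / (2 * pi) * (\<integral>t. F t \<partial>lborel))"
    using F_sums by (rule sums_mult)
  ultimately have "(\<lambda>n. complex_of_real (\<gamma> n * d n)) sums of_real (measure P {a<..b})"
    by simp
  then have "(\<lambda>n. \<gamma> n * d n) sums measure P {a<..b}"
    by (simp only: sums_of_real_iff)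
  moreover have "(\<lambda>n. d n / fact (Suc n) * b ^ Suc n - d n / fact (Suc n) * a ^ Suc n) sums (taylor_cdf b - taylor_cdf a)"
    unfolding taylor_cdf_def using summable_taylor_cdf by (intro sums_diff summable_sums)
  moreover have "d n / fact (Suc n) * b ^ Suc n - d n / fact (Suc n) * a ^ Suc n = \<gamma> n * d n" for n
    by (simp add: \<gamma>_def diff_divide_distrib algebra_simps del: fact_Suc power_Suc)
  ultimately show ?thesis by (simp add: sums_unique2)
qed

text \<open>A finite measure has countably many atoms, while an open interval is
  uncountable.\<close>

lemma ex_nonatom: 
  assumes "u < v"
  shows "\<exists>y. u < y \<and> y < v \<and> measure P {y} = 0"
proof (rule ccontr)
  assume "\<not> ?thesis"
  then have "{u<..<v} \<subseteq> {x. measure P {x} > 0}"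
    by (auto simp: zero_less_measure_iff)
  then have "countable {u<..<v}"
    using countable_atoms countable_subset by blast
  then show False using assms uncountable_open_interval by blast
qed

text \<open>An atom at \<open>x\<close> would keep its mass in arbitrarily short intervals around
  \<open>x\<close> with non-atomic endpoints, whose mass tends to 0 by continuity of
  \<open>taylor_cdf\<close>.\<close>

lemma measure_singleton_eq_0: "measure P {x} = 0"
proof (rule ccontr)
  define e where "e = measure P {x}"
  assume "measure P {x} \<noteq> 0"
  then have "e > 0" by (simp add: e_def less_le)
  moreover have "isCont taylor_cdf x" using DERIV_taylor_cdf by (rule DERIV_isCont)
  ultimately obtain \<delta> where \<delta>: "\<delta> > 0" "\<And>y. \<bar>y - x\<bar> < \<delta> \<Longrightarrow> \<bar>taylor_cdf y - taylor_cdf x\<bar> < e / 2"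
    unfolding continuous_at_eps_delta dist_real_def by (metis half_gt_zero)
  obtain a where a: "x - \<delta> < a" "a < x" "measure P {a} = 0" using ex_nonatom[of "x - \<delta>" x] \<delta> by auto
  obtain b where b: "x < b" "b < x + \<delta>" "measure P {b} = 0" using ex_nonatom[of x "x + \<delta>"] \<delta> by auto
  have "e \<le> measure P {a<..b}" unfolding e_def using a b by (intro finite_measure_mono) auto
  also have "\<dots> = taylor_cdf b - taylor_cdf a" using a b by (intro measure_Ioc_nonatoms) auto
  also have "\<dots> < e" using \<delta>(2)[of a] \<delta>(2)[of b] a b by linarith
  finally show False by simp
qed

lemma measure_Ioc: "a \<le> b \<Longrightarrow> measure P {a<..b} = taylor_cdf b - taylor_cdf a"
  by (intro measure_Ioc_nonatoms measure_singleton_eq_0)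

text \<open>The series shows no sign; it comes from \<open>taylor_cdf\<close>, which is monotone
  because its increments are probabilities.\<close>

lemma taylor_density_nonneg: "0 \<le> taylor_density x"
proof (rule mono_on_imp_deriv_nonneg)
  show "mono_on UNIV taylor_cdf"
  proof (rule mono_onI)
    fix a b :: real assume "a \<le> b"
    then show "taylor_cdf a \<le> taylor_cdf b" using measure_Ioc[of a b] measure_nonneg[of P "{a<..b}"] by linarith
  qed
qed (use DERIV_taylor_cdf in auto)

text \<open>Half-open intervals form an intersection-stable generator of the Borel sets, and on them
  both measures are increments of \<open>taylor_cdf\<close>.\<close>

theorem eq_density_taylor: "P = density lborel taylor_density"
proof (rule measure_eqI_generator_eq)
  let ?E = "range (\<lambda>(a, b). {a<..b::real})"
  show "Int_stable ?E" by (auto simp: Int_stable_def)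
  show "sets P = sigma_sets UNIV ?E" "sets (density lborel taylor_density) = sigma_sets UNIV ?E"
    by (simp_all add: borel_sigma_sets_Ioc)
  show "range (\<lambda>n. {- real n<..real n}) \<subseteq> ?E" by auto
  show "(\<Union>n. {- real n<..real n}) = UNIV"
  proof (rule UNIV_eq_I[symmetric])
    fix x :: real
    obtain n :: nat where "\<bar>x\<bar> < real n" using reals_Archimedean2 by blast
    then show "x \<in> (\<Union>n. {- real n<..real n})" by (intro UN_I[of n]) auto
  qed
  fix X assume "X \<in> ?E"
  then obtain a b where X: "X = {a<..b}" by auto
  show "emeasure P X = emeasure (density lborel taylor_density) X"
  proof (cases "a \<le> b")
    case True
    have "emeasure (density lborel taylor_density) X = (\<integral>\<^sup>+x. ennreal (taylor_density x) * indicator {a<..b} x \<partial>lborel)"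
      unfolding X by (rule emeasure_density) auto
    also have "\<dots> = (\<integral>\<^sup>+x. ennreal (taylor_density x) * indicator {a..b} x \<partial>lborel)"
      by (rule nn_integral_cong_AE, use AE_lborel_singleton[of a] in eventually_elim) (auto simp: indicator_def)
    also have "\<dots> = ennreal (taylor_cdf b - taylor_cdf a)"
      using True by (intro nn_integral_FTC_Icc) (auto intro: DERIV_taylor_cdf taylor_density_nonneg)
    finally show ?thesis using True by (simp add: X emeasure_eq_measure measure_Ioc)
  qed (simp add: X)
qed auto

end

subsection \<open>Termwise integration against an exponential\<close>

text \<open>A Weierstrass majorant on a bounded interval: the integrals of the norms are at most
  \<open>B n * (q - p)\<close>.\<close>

lemma
  fixes f :: "nat \<Rightarrow> real \<Rightarrow> real"
  assumes cont: "\<And>n. continuous_on {p..q} (f n)"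
    and bound: "\<And>n x. x \<in> {p..q} \<Longrightarrow> \<bar>f n x\<bar> \<le> B n"
    and B: "summable B"
    and sums: "\<And>x. x \<in> {p..q} \<Longrightarrow> (\<lambda>n. f n x) sums F x"
  shows sums_lborel_integral_Icc: "(\<lambda>n. \<integral>x. f n x * indicator {p..q} x \<partial>lborel) sums (\<integral>x. F x * indicator {p..q} x \<partial>lborel)"
    and integrable_lborel_Icc_sums: "integrable lborel (\<lambda>x. F x * indicator {p..q} x)"
proof -
  have fi: "integrable lborel (\<lambda>x. f n x * indicator {p..q} x)" for n
    using borel_integrable_atLeastAtMost'[OF cont] by (simp add: set_integrable_def mult.commute)
  have B_nonneg: "0 \<le> B n" if "p \<le> q" for n
    using bound[of p n] that by force
  have "summable (\<lambda>n. norm (f n x * indicator {p..q} x))" for x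
    using bound by (cases "x \<in> {p..q}") (auto intro: summable_comparison_test'[OF B])
  then have ae: "AE x in lborel. summable (\<lambda>n. norm (f n x * indicator {p..q} x))" by simp
  have summ: "summable (\<lambda>n. \<integral>x. norm (f n x * indicator {p..q} x) \<partial>lborel)"
  proof (cases "p \<le> q")
    case True
    show ?thesis
    proof (rule summable_comparison_test')
      show "summable (\<lambda>n. B n * (q - p))" using B by (rule summable_mult2)
      fix n
      have "(\<integral>x. norm (f n x * indicator {p..q} x) \<partial>lborel) \<le> (\<integral>x. B n * indicator {p..q} x \<partial>lborel)"
        using bound by (intro integral_mono integrable_norm fi integrable_mult_right integrable_real_indicator)
          (auto simp: abs_mult emeasure_lborel_Icc_eq split: split_indicator)
      also have "\<dots> = B n * (q - p)" using True by simp
      finally show "norm (\<integral>x. norm (f n x * indicator {p..q} x) \<partial>lborel) \<le> B n * (q - p)"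
        by simp
    qed
  qed simp
  have "(\<lambda>n. f n x * indicator {p..q} x) sums (F x * indicator {p..q} x)" for x
    using sums by (cases "x \<in> {p..q}") auto
  then have eq: "(\<Sum>n. f n x * indicator {p..q} x) = F x * indicator {p..q} x" for x
    by (rule sums_unique[symmetric])
  show "(\<lambda>n. \<integral>x. f n x * indicator {p..q} x \<partial>lborel) sums (\<integral>x. F x * indicator {p..q} x \<partial>lborel)"
    using sums_integral[OF fi ae summ] unfolding eq .
  show "integrable lborel (\<lambda>x. F x * indicator {p..q} x)"
    using integrable_suminf[OF fi ae summ] unfolding eq .
qed

text \<open>Expanding \<open>exp (w * x)\<close> and integrating the monomials produces the inner
  series of the asset-or-nothing part when \<open>w = u\<close>.\<close>

lemma sums_integral_power_exp:
  fixes p q w :: real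
  assumes "p \<le> q"
  shows "(\<lambda>m. w ^ m / fact m * ((q ^ (1 + n + m) - p ^ (1 + n + m)) / real (1 + n + m))) sums
    (\<integral>x. x ^ n * exp (w * x) * indicator {p..q} x \<partial>lborel)"
proof -
  define r where "r = max \<bar>p\<bar> \<bar>q\<bar>"
  have r: "\<bar>x\<bar> \<le> r" if "x \<in> {p..q}" for x using that by (auto simp: r_def)
  have "(\<lambda>m. \<integral>x. (w ^ m / fact m * x ^ (n + m)) * indicator {p..q} x \<partial>lborel) sums
     (\<integral>x. x ^ n * exp (w * x) * indicator {p..q} x \<partial>lborel)"
  proof (rule sums_lborel_integral_Icc)
    show "continuous_on {p..q} (\<lambda>x. w ^ m / fact m * x ^ (n + m))" for m
      by (intro continuous_intros)
    show "summable (\<lambda>m. r ^ n * (inverse (fact m) * (\<bar>w\<bar> * r) ^ m))"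
      by (intro summable_mult summable_exp)
    show "\<bar>w ^ m / fact m * x ^ (n + m)\<bar> \<le> r ^ n * (inverse (fact m) * (\<bar>w\<bar> * r) ^ m)" if "x \<in> {p..q}" for x m
    proof -
      have "\<bar>w ^ m / fact m * x ^ (n + m)\<bar> = \<bar>w\<bar> ^ m / fact m * \<bar>x\<bar> ^ (n + m)"
        by (simp add: abs_mult power_abs)
      also have "\<dots> \<le> \<bar>w\<bar> ^ m / fact m * r ^ (n + m)"
        using r[OF that] by (intro mult_left_mono power_mono) auto
      finally show ?thesis by (simp add: power_add power_mult_distrib divide_inverse mult_ac)
    qed
    show "(\<lambda>m. w ^ m / fact m * x ^ (n + m)) sums (x ^ n * exp (w * x))" for x
    proof -
      have "(\<lambda>m. x ^ n * ((w * x) ^ m /\<^sub>R fact m)) sums (x ^ n * exp (w * x))"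
        by (intro sums_mult exp_converges)
      then show ?thesis by (simp add: power_add power_mult_distrib divide_inverse mult_ac)
    qed
  qed
  moreover have "(\<integral>x. (w ^ m / fact m * x ^ (n + m)) * indicator {p..q} x \<partial>lborel) =
      w ^ m / fact m * ((q ^ (1 + n + m) - p ^ (1 + n + m)) / real (1 + n + m))" for m
    using integral_power[OF assms, of "n + m"] unfolding mult.assoc by simp
  ultimately show ?thesis by simp
qed

text \<open>On the interval the exponential weight is bounded, so the power series, absolutely
  convergent at the radius \<open>r\<close>, supplies the majorant. It is applied with
  \<open>w = u\<close> for the asset part and \<open>w = 0\<close> for the cash part.\<close>

lemma
  fixes p q w :: real
  assumes e: "\<And>x. summable (\<lambda>n. norm (e n * x ^ n))" and f: "\<And>x. (\<lambda>n. e n * x ^ n) sums f x"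
  shows sums_integral_power_series_exp:
      "(\<lambda>n. e n * (\<integral>x. x ^ n * exp (w * x) * indicator {p..q} x \<partial>lborel)) sums
       (\<integral>x. f x * exp (w * x) * indicator {p..q} x \<partial>lborel)"
    and integrable_power_series_exp: "integrable lborel (\<lambda>x. f x * exp (w * x) * indicator {p..q} x)"
proof -
  define r where "r = max \<bar>p\<bar> \<bar>q\<bar>"
  have r: "\<bar>x\<bar> \<le> r" if "x \<in> {p..q}" for x using that by (auto simp: r_def)
  have cont: "continuous_on {p..q} (\<lambda>x. e n * (x ^ n * exp (w * x)))" for n
    by (intro continuous_intros)
  have B: "summable (\<lambda>n. norm (e n * r ^ n) * exp (\<bar>w\<bar> * r))"
    by (intro summable_mult2 e)
  have bound: "\<bar>e n * (x ^ n * exp (w * x))\<bar> \<le> norm (e n * r ^ n) * exp (\<bar>w\<bar> * r)" if "x \<in> {p..q}" for x n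
  proof -
    have "w * x \<le> \<bar>w\<bar> * r" using r[OF that] by (metis abs_ge_self abs_mult mult_left_mono abs_ge_zero order_trans)
    then have "\<bar>e n\<bar> * \<bar>x\<bar> ^ n * exp (w * x) \<le> \<bar>e n\<bar> * r ^ n * exp (\<bar>w\<bar> * r)"
      using r[OF that] by (intro mult_mono power_mono) auto
    moreover have "\<bar>r\<bar> = r" by (simp add: r_def)
    ultimately show ?thesis by (simp add: abs_mult power_abs)
  qed
  have sums: "(\<lambda>n. e n * (x ^ n * exp (w * x))) sums (f x * exp (w * x))" for x
    using sums_mult2[OF f[of x], of "exp (w * x)"] by (simp add: mult.assoc)
  show "(\<lambda>n. e n * (\<integral>x. x ^ n * exp (w * x) * indicator {p..q} x \<partial>lborel)) sums
       (\<integral>x. f x * exp (w * x) * indicator {p..q} x \<partial>lborel)"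
    using sums_lborel_integral_Icc[OF cont bound B sums] unfolding mult.assoc[of "e _"] by simp
  show "integrable lborel (\<lambda>x. f x * exp (w * x) * indicator {p..q} x)"
    using integrable_lborel_Icc_sums[OF cont bound B sums] .
qed

subsection \<open>The option value\<close>

text \<open>The signed moments involve the modulus \<open>c\<close> of the complex rate, the
  absolute moments its real part \<open>A\<close>.\<close>

lemma exp_integrable_char_stable:
  assumes "real_distribution P" "1 < \<alpha>" "\<alpha> \<le> 2" "0 < A" "\<And>t. char P t = stable_char \<alpha> A t"
    and "c = - A / cos (pi * \<alpha> / 2)"
  shows "exp_integrable_char P (\<lambda>n. (- 1) ^ n * rGamma (1 - real (Suc n) / \<alpha>) / \<alpha> * c powr (- (real (Suc n) / \<alpha>)))"
proof -
  interpret real_distribution P by fact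
  have char_eq: "char P = stable_char \<alpha> A" using assms by auto
  show ?thesis
  proof unfold_locales
    show "has_bochner_integral lborel (\<lambda>t. (- \<i> * of_real t) ^ n * char P t)
      (of_real (2 * pi * ((- 1) ^ n * rGamma (1 - real (Suc n) / \<alpha>) / \<alpha> * c powr (- (real (Suc n) / \<alpha>)))))" for n
      unfolding char_eq assms(6) by (rule has_bochner_integral_power_stable_char) fact+
    have "(\<integral>t. norm ((- \<i> * of_real t) ^ n * char P t) \<partial>lborel) =
        2 * (Gamma (real (Suc n) / \<alpha>) / \<alpha> * A powr (- (real (Suc n) / \<alpha>)))" for n
      unfolding char_eq using has_bochner_integral_power_norm_stable_char[OF assms(2,4)]
      by (rule has_bochner_integral_integral_eq)
    moreover fix R :: real assume "0 \<le> R"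
    ultimately show "summable (\<lambda>n. R ^ n / fact n * (\<integral>t. norm ((- \<i> * of_real t) ^ n * char P t) \<partial>lborel))"
      using summable_mult[OF summable_power_Gamma_div_fact[OF assms(2,4)], of R 2] by (simp add: mult_ac)
  qed
qed

lemma capped_power_call_payoff_asset_price:
  assumes "0 < u" "0 < S" "0 < K\<^sub>m" "K\<^sub>m < K\<^sub>p"
    and "k\<^sub>m = ln (S / K\<^sub>m powr (1 / u)) + r * \<tau>"
    and "k\<^sub>p = ln (S / K\<^sub>p powr (1 / u)) + r * \<tau>"
  shows "capped_power_call_payoff u K\<^sub>m K\<^sub>p (asset_price X S r \<mu> \<tau> \<omega>) =
    (S powr u * exp (u * (r + \<mu>) * \<tau>) * exp (u * X \<tau> \<omega>) - K\<^sub>m) *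
      indicator {- (k\<^sub>m + \<mu> * \<tau>)<..<- (k\<^sub>p + \<mu> * \<tau>)} (X \<tau> \<omega>)"
proof -
  define x where "x = X \<tau> \<omega>"
  define Y where "Y = (S * exp ((r + \<mu>) * \<tau> + x)) powr u"
  have "exp y powr u = exp (u * y)" for y :: real by (simp add: powr_def)
  then have Y: "Y = S powr u * exp (u * (r + \<mu>) * \<tau>) * exp (u * x)"
    using assms by (simp add: Y_def powr_mult mult.assoc exp_add[symmetric]) (simp add: algebra_simps)
  have "Y > 0" using assms by (simp add: Y_def)
  have lnY: "ln Y = u * (ln S + (r + \<mu>) * \<tau> + x)"
    using assms by (simp add: Y_def ln_powr ln_mult)
  \<comment> \<open>Taking logarithms turns each strike condition on \<open>Y\<close> into a
    comparison of \<open>x\<close> with \<open>- (k + \<mu> * \<tau>)\<close>; division by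
    \<open>u > 0\<close> preserves its direction.\<close>
  have uk: "ln K - u * (ln S + (r + \<mu>) * \<tau> + x) = u * (- (ln (S / K powr (1 / u)) + r * \<tau> + \<mu> * \<tau>) - x)"
    if "K > 0" for K
    using assms that by (simp add: ln_div ln_powr field_simps)
  have "K\<^sub>m < Y \<longleftrightarrow> ln K\<^sub>m - ln Y < 0" using \<open>Y > 0\<close> assms by simp
  then have 1: "K\<^sub>m < Y \<longleftrightarrow> - (k\<^sub>m + \<mu> * \<tau>) < x"
    unfolding lnY uk[OF \<open>0 < K\<^sub>m\<close>] assms(5)[symmetric] using \<open>0 < u\<close>
    by (auto simp: mult_less_0_iff)
  have "Y < K\<^sub>p \<longleftrightarrow> 0 < ln K\<^sub>p - ln Y" using \<open>Y > 0\<close> assms by simp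
  then have 2: "Y < K\<^sub>p \<longleftrightarrow> x < - (k\<^sub>p + \<mu> * \<tau>)"
    unfolding lnY uk[OF order.strict_trans[OF \<open>0 < K\<^sub>m\<close> \<open>K\<^sub>m < K\<^sub>p\<close>]] assms(6)[symmetric] using \<open>0 < u\<close>
    by (auto simp: zero_less_mult_iff)
  have "capped_power_call_payoff u K\<^sub>m K\<^sub>p (asset_price X S r \<mu> \<tau> \<omega>) = (Y - K\<^sub>m) * indicator {K\<^sub>m<..<K\<^sub>p} Y"
    by (simp add: capped_power_call_payoff_def asset_price_def Y_def x_def)
  also have "indicator {K\<^sub>m<..<K\<^sub>p} Y = (indicator {- (k\<^sub>m + \<mu> * \<tau>)<..<- (k\<^sub>p + \<mu> * \<tau>)} x :: real)"
    using 1 2 by (simp add: indicator_def)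
  finally show ?thesis by (simp add: Y x_def)
qed

text \<open>\<open>suminf\<close> represents a series value only under summability, so convergence
  of the inner, outer and cash series is part of the conclusion.\<close>

theorem mainTheorem9:
  fixes M :: "'a measure" and X :: "real \<Rightarrow> 'a \<Rightarrow> real"
    and \<alpha> \<sigma> u S K\<^sub>m K\<^sub>p r \<tau> \<mu> k\<^sub>m k\<^sub>p AN CN :: real
    and a :: "nat \<Rightarrow> nat \<Rightarrow> real" and c :: "nat \<Rightarrow> real"
  assumes "1 < \<alpha>" and "\<alpha> \<le> 2" and "0 < \<sigma>" and "0 < u" and "0 < S"
    and "0 < K\<^sub>m" and "K\<^sub>m < K\<^sub>p" and "0 < \<tau>"
    and "spectrally_negative_stable_process M X \<alpha> \<sigma>"
    and "\<mu> = \<sigma> powr \<alpha> / cos (pi * \<alpha> / 2)"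
    and "k\<^sub>m = ln (S / K\<^sub>m powr (1 / u)) + r * \<tau>"
    and "k\<^sub>p = ln (S / K\<^sub>p powr (1 / u)) + r * \<tau>"
    and "a = (\<lambda>n m. (- u) ^ m * ((k\<^sub>m + \<mu> * \<tau>) ^ (1 + n + m) - (k\<^sub>p + \<mu> * \<tau>) ^ (1 + n + m))
                / (real (1 + n + m) * fact n * fact m)
                * rGamma (1 - real (1 + n) / \<alpha>)
                * (- \<mu> * \<tau>) powr (- (real (1 + n) / \<alpha>)))"
    and "c = (\<lambda>n. 1 / fact n * rGamma (1 - real n / \<alpha>)
                * ((k\<^sub>m + \<mu> * \<tau>) ^ n - (k\<^sub>p + \<mu> * \<tau>) ^ n)
                * (- \<mu> * \<tau>) powr (- (real n / \<alpha>)))"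
    and "AN = exp (- r * \<tau>) / \<alpha> * S powr u * exp (u * (r + \<mu>) * \<tau>) * (\<Sum>n. \<Sum>m. a n m)"
    and "CN = exp (- r * \<tau>) / \<alpha> * (\<Sum>n. c n)"
  shows "(\<forall>n. summable (a n)) \<and> summable (\<lambda>n. \<Sum>m. a n m) \<and> summable c \<and>
    option_value M X S r \<mu> \<tau> (capped_power_call_payoff u K\<^sub>m K\<^sub>p) = AN - K\<^sub>m * CN"
proof -
  interpret spectrally_negative_stable_process M X \<alpha> \<sigma> by fact
  define P where "P = distr M borel (X \<tau>)"
  have X_meas [measurable]: "X \<tau> \<in> borel_measurable M"
    using random_variable_process \<open>0 < \<tau>\<close> by simp
  have dist: "real_distribution P"
    unfolding P_def by (rule real_distribution_distr) simp
  define A where "A = \<tau> * \<sigma> powr \<alpha>"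
  define C where "C = - \<mu> * \<tau>"
  define d where "d = (\<lambda>n. (- 1) ^ n * rGamma (1 - real (Suc n) / \<alpha>) / \<alpha> * C powr (- (real (Suc n) / \<alpha>)))"
  interpret P: exp_integrable_char P d
    unfolding d_def
  proof (rule exp_integrable_char_stable[where A = A])
    show "char P t = stable_char \<alpha> A t" for t
      using characteristic_function[of \<tau> t] \<open>0 < \<tau>\<close>
      by (simp add: P_def stable_char_def A_def)
    show "0 < A" using assms by (simp add: A_def)
    show "C = - A / cos (pi * \<alpha> / 2)" using assms by (simp add: C_def A_def)
  qed (use dist assms in auto)
  define f where "f = P.taylor_density"
  define p where "p = - (k\<^sub>m + \<mu> * \<tau>)"
  define q where "q = - (k\<^sub>p + \<mu> * \<tau>)"
  have "k\<^sub>p < k\<^sub>m"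
    using assms by (simp add: ln_div ln_powr divide_strict_right_mono)
  then have "p \<le> q" by (simp add: p_def q_def)
  \<comment> \<open>\<open>I u\<close> and \<open>I 0\<close> are the expectations of
    \<open>exp (u * X \<tau>)\<close> and of 1 over the exercise interval; \<open>J\<close> holds
    the termwise integrals of their expansions.\<close>
  define J where "J = (\<lambda>w n. \<integral>x. x ^ n * exp (w * x) * indicator {p..q} x \<partial>lborel)"
  define I where "I = (\<lambda>w. \<integral>x. f x * exp (w * x) * indicator {p..q} x \<partial>lborel)"
  have J: "(\<lambda>m. w ^ m / fact m * ((q ^ (1 + n + m) - p ^ (1 + n + m)) / real (1 + n + m))) sums J w n" for w n
    unfolding J_def using \<open>p \<le> q\<close> by (rule sums_integral_power_exp)
  have I: "(\<lambda>n. d n / fact n * J w n) sums I w" for w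
    unfolding J_def I_def f_def
    by (rule sums_integral_power_series_exp[OF P.summable_norm_taylor_density P.taylor_density_sums])
  have f_int: "integrable lborel (\<lambda>x. f x * exp (w * x) * indicator {p..q} x)" for w
    unfolding f_def
    by (rule integrable_power_series_exp[OF P.summable_norm_taylor_density P.taylor_density_sums])

  have pq_diff: "q ^ k - p ^ k = (- 1) ^ Suc k * ((k\<^sub>m + \<mu> * \<tau>) ^ k - (k\<^sub>p + \<mu> * \<tau>) ^ k)" for k
    unfolding p_def q_def power_minus[of "k\<^sub>m + \<mu> * \<tau>"] power_minus[of "k\<^sub>p + \<mu> * \<tau>"]
    by (simp add: algebra_simps)
  have a_eq: "a n m = \<alpha> * (d n / fact n) * (u ^ m / fact m * ((q ^ (1 + n + m) - p ^ (1 + n + m)) / real (1 + n + m)))" for n m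
  proof -
    \<comment> \<open>The signs of \<open>d n\<close> and of \<open>pq_diff\<close> multiply to
      \<open>(- 1) ^ m\<close>, which is the sign inside \<open>(- u) ^ m\<close>.\<close>
    have "(- 1) ^ n * (- 1) ^ Suc (1 + n + m) * u ^ m = (- u) ^ m"
      by (cases "even n"; cases "even m") auto
    moreover have "\<alpha> * (s * G / \<alpha> * Q / F) * (v / F' * (s' * D / k)) = s * s' * v * D / (k * F * F') * G * Q"
      for s s' G Q F F' v D k
      using \<open>1 < \<alpha>\<close> by (simp add: mult_ac)
    ultimately show ?thesis
      unfolding pq_diff assms(13) d_def C_def by (simp only: Suc_eq_plus1_left)
  qed
  have a_sums: "a n sums (\<alpha> * (d n / fact n) * J u n)" for n
    unfolding a_eq[abs_def] by (rule sums_mult[OF J])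
  have a_suminf: "(\<Sum>m. a n m) = \<alpha> * (d n / fact n * J u n)" for n
    using sums_unique[OF a_sums[of n]] by simp
  have a_sums_sums: "(\<lambda>n. \<Sum>m. a n m) sums (\<alpha> * I u)"
    unfolding a_suminf by (rule sums_mult[OF I])

  have J0: "J 0 n = (q ^ Suc n - p ^ Suc n) / real (Suc n)" for n
    unfolding J_def using integral_power[OF \<open>p \<le> q\<close>, of n] by simp
  have c_Suc: "c (Suc n) = \<alpha> * (d n / fact n * J 0 n)" for n
  proof -
    have "(- 1) ^ n * (- 1) ^ Suc (Suc n) = (1::real)" by (cases "even n") auto
    moreover have "\<alpha> * (s * G / \<alpha> * Q / F * (s' * D / k)) = s * s' * (1 / (k * F) * G * D * Q)"
      for s s' G Q F D k
      using \<open>1 < \<alpha>\<close> by (simp add: mult_ac)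
    ultimately show ?thesis
      unfolding J0 pq_diff assms(14) d_def C_def fact_Suc by (simp only: mult_1_left)
  qed
  have "(\<lambda>n. c (Suc n)) sums (\<alpha> * I 0)"
    unfolding c_Suc by (rule sums_mult[OF I])
  \<comment> \<open>The index shift is free: \<open>c 0 = 0\<close>, since both zeroth powers are
    1.\<close>
  from sums_Suc[OF this] have c_sums: "c sums (\<alpha> * I 0)"
    by (simp add: assms(14))

  define E where "E = S powr u * exp (u * (r + \<mu>) * \<tau>)"
  define H where "H = (\<lambda>x. (E * exp (u * x) - K\<^sub>m) * indicator {p<..<q} x)"
  have [measurable]: "H \<in> borel_measurable borel" unfolding H_def by measurable
  have [measurable]: "f \<in> borel_measurable borel" unfolding f_def by measurable
  have "(\<integral>\<omega>. capped_power_call_payoff u K\<^sub>m K\<^sub>p (asset_price X S r \<mu> \<tau> \<omega>) \<partial>M) = (\<integral>\<omega>. H (X \<tau> \<omega>) \<partial>M)"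
    unfolding capped_power_call_payoff_asset_price[OF assms(4-7,11,12)] H_def E_def p_def q_def ..
  also have "\<dots> = (\<integral>x. H x \<partial>P)" unfolding P_def by (rule integral_distr[symmetric]) auto
  also have "\<dots> = (\<integral>x. f x * H x \<partial>lborel)"
    unfolding f_def by (subst P.eq_density_taylor, subst integral_real_density)
      (auto intro: P.taylor_density_nonneg)
  \<comment> \<open>The payoff lives on the open interval, the termwise integrals on the closed one;
    they differ only at the null points \<open>p\<close> and \<open>q\<close>.\<close>
  also have "\<dots> = (\<integral>x. E * (f x * exp (u * x) * indicator {p..q} x) - K\<^sub>m * (f x * exp (0 * x) * indicator {p..q} x) \<partial>lborel)"
  proof (rule integral_cong_AE)
    show "AE x in lborel. f x * H x = E * (f x * exp (u * x) * indicator {p..q} x) - K\<^sub>m * (f x * exp (0 * x) * indicator {p..q} x)"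
      using AE_lborel_singleton[of p] AE_lborel_singleton[of q]
      by eventually_elim (auto simp: H_def indicator_def algebra_simps)
  qed auto
  also have "\<dots> = E * I u - K\<^sub>m * I 0"
    unfolding I_def using f_int[of u] f_int[of 0] by (subst Bochner_Integration.integral_diff) auto
  finally have "option_value M X S r \<mu> \<tau> (capped_power_call_payoff u K\<^sub>m K\<^sub>p) = exp (- r * \<tau>) * (E * I u - K\<^sub>m * I 0)"
    by (simp add: option_value_def)
  also have "\<dots> = AN - K\<^sub>m * CN"
    using \<open>1 < \<alpha>\<close> unfolding assms(15,16) sums_unique[OF a_sums_sums, symmetric] sums_unique[OF c_sums, symmetric]
    by (simp add: E_def algebra_simps)
  finally show ?thesis
    using a_sums a_sums_sums c_sums by (auto intro: sums_summable)
qed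

end
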